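(* Let $n\ge0$ be an integer. Define $Q,\tilde Q:(\max\{\sqrt{\chi_n}/c,1\},\infty)\to\mathbb R$ by $$Q(t)=\psi_n^2(t)+\frac{(t^2-1)(\psi_n'(t))^2}{c^2t^2-\chi_n},\qquad \tilde Q(t)=(t^2-1)\big((c^2t^2-\chi_n)\psi_n^2(t)+(t^2-1)(\psi_n'(t))^2\big).$$ Then $Q$ is decreasing and $\tilde Q$ is increasing on $(\max\{\sqrt{\chi_n}/c,1\},\infty)$.
   Context: For a real number $c>0$, let $\psi_0,\psi_1,\dots$ be the prolate spheroidal wave functions of band limit $c$: the real $L^2[-1,1]$-normalized eigenfunctions of $F_c[\varphi](x)=\int_{-1}^1\varphi(t)e^{icxt}\,dt$ with eigenvalues $\lambda_n$ ordered by $|\lambda_n|\ge|\lambda_{n+1}|$, extended to entire functions by $\lambda_n\psi_n(x)=\int_{-1}^1\psi_n(t)e^{icxt}\,dt$. $\chi_0<\chi_1<\dots$ are the positive numbers such that $\psi_n$ satisfies $(1-x^2)\psi''(x)-2x\psi'(x)+(\chi_n-c^2x^2)\psi(x)=0$ for all real $x$. *)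

theory Defs
  imports "HOL-Analysis.Analysis"
begin

definition fin_fourier :: "real \<Rightarrow> (real \<Rightarrow> real) \<Rightarrow> real \<Rightarrow> complex" where
  "fin_fourier c \<phi> x =
     integral {-1..1} (\<lambda>t. complex_of_real (\<phi> t) * exp (\<i> * complex_of_real (c * x * t)))"

text \<open>psi, lam, chi form the system of prolate spheroidal wave functions of band limit c:
  psi n are real, L2[-1,1]-orthonormal eigenfunctions of F_c with eigenvalues lam n, extended
  to the whole real line by  lam n * psi n x = F_c[psi n](x);  the eigenvalues are ordered by
  non-increasing modulus; every (continuous, nonzero) real eigenfunction of F_c has its
  eigenvalue among the lam n (the family exhausts the spectrum); chi is the strictly
  increasing sequence of positive numbers for which psi n satisfies the prolate ODE on the
  real line.\<close>
definition pswf_system ::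
  "real \<Rightarrow> (nat \<Rightarrow> real \<Rightarrow> real) \<Rightarrow> (nat \<Rightarrow> complex) \<Rightarrow> (nat \<Rightarrow> real) \<Rightarrow> bool" where
  "pswf_system c \<psi> lam chi \<longleftrightarrow>
     (\<forall>n. (\<lambda>t. (\<psi> n t)\<^sup>2) integrable_on {-1..1}
          \<and> integral {-1..1} (\<lambda>t. (\<psi> n t)\<^sup>2) = 1
          \<and> (\<forall>x. lam n * complex_of_real (\<psi> n x) = fin_fourier c (\<psi> n) x))
   \<and> (\<forall>m n. m \<noteq> n \<longrightarrow> integral {-1..1} (\<lambda>t. \<psi> m t * \<psi> n t) = 0)
   \<and> (\<forall>n. norm (lam n) \<ge> norm (lam (Suc n)))
   \<and> (\<forall>\<phi> \<mu>. continuous_on {-1..1} \<phi> \<longrightarrow> (\<exists>t\<in>{-1..1}. \<phi> t \<noteq> 0) \<longrightarrow>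
        (\<forall>x\<in>{-1..1}. \<mu> * complex_of_real (\<phi> x) = fin_fourier c \<phi> x) \<longrightarrow>
        (\<exists>n. \<mu> = lam n))
   \<and> strict_mono chi \<and> (\<forall>n. chi n > 0)
   \<and> (\<forall>n x. (1 - x\<^sup>2) * deriv (deriv (\<psi> n)) x - 2 * x * deriv (\<psi> n) x
              + (chi n - c\<^sup>2 * x\<^sup>2) * \<psi> n x = 0)"

end

theory Submission
  imports Defs "HOL-Complex_Analysis.Conformal_Mappings"
begin

text \<open>With \<open>p = t\<^sup>2 - 1\<close> and \<open>q = c\<^sup>2t\<^sup>2 - \<chi>\<close> the equation reads \<open>(p\<psi>')' = -q\<psi>\<close>, whence
  \<open>Q' = -2t\<psi>'\<^sup>2 / q - 2c\<^sup>2tp\<psi>'\<^sup>2 / q\<^sup>2\<close> and \<open>Q~' = 2t\<psi>\<^sup>2 (q + c\<^sup>2p)\<close>. Strictness holds because \<open>\<psi>\<close> extends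
  to a nonzero entire function and so vanishes on no interval.

  The smoothness of \<open>\<psi>\<close> comes from \<open>\<lambda>\<psi> = F\<^sub>c[\<psi>]\<close>, provided that \<open>\<lambda> \<noteq> 0\<close>, i.e. that \<open>F\<^sub>c\<close> does not
  annihilate \<open>\<psi>\<close>. The definition of the system does not say that \<open>\<psi>\<close> is measurable, and for a
  non-measurable \<open>\<psi>\<close> the integral \<open>F\<^sub>c[\<psi>]\<close> would be the junk value \<open>0\<close>. Measurability is extracted from the
  differential equation, read with the junk values of \<^const>\<open>deriv\<close>; then \<open>\<psi>\<close> is integrable on
  \<open>[-1,1]\<close> and \<open>F\<^sub>c\<close> is injective on integrable functions.\<close>

subsection \<open>Functions satisfying a linear equation in formal derivatives\<close>

text \<open>An isolated point is the only point of \<open>E\<close> in some interval with rational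
  endpoints, and there are only countably many such intervals.\<close>

lemma countable_isolated_points:
  fixes E :: "real set"
  shows "countable {x \<in> E. \<not> x islimpt E}"
proof (rule countable_subset)
  let ?S = "\<lambda>p. {x. E \<inter> {fst p<..<snd p} = {x}}"
  have "finite (?S p)" for p
    by (cases "\<exists>x. E \<inter> {fst p<..<snd p} = {x}") auto
  then show "countable (\<Union>p\<in>\<rat> \<times> \<rat>. ?S p)"
    by (intro countable_UN countable_SIGMA countable_rat) (auto intro: countable_finite)
  show "{x \<in> E. \<not> x islimpt E} \<subseteq> (\<Union>p\<in>\<rat> \<times> \<rat>. ?S p)"
  proof safe
    fix x assume x: "x \<in> E" "\<not> x islimpt E"
    then obtain d where d: "d > 0" "\<And>y. y \<in> E \<Longrightarrow> dist y x < d \<Longrightarrow> y = x"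
      by (metis islimpt_approachable)
    obtain r where r: "r \<in> \<rat>" "x - d < r" "r < x"
      using Rats_dense_in_real[of "x - d" x] d by auto
    obtain s where s: "s \<in> \<rat>" "x < s" "s < x + d"
      using Rats_dense_in_real[of x "x + d"] d by auto
    have "E \<inter> {r<..<s} = {x}"
      using d r s x by (auto simp: dist_real_def abs_less_iff)
    then show "x \<in> (\<Union>p\<in>\<rat> \<times> \<rat>. ?S p)"
      using r s by (intro UN_I[of "(r, s)"]) auto
  qed
qed

text \<open>Rational slopes and radii \<open>1 / Suc k\<close> leave only countable quantifiers over
  slopes and radii, as Borel measurability needs. Conversely, slopes that fit at finer and finer
  tolerances form a Cauchy sequence, and its limit is the derivative.\<close>

lemma differentiable_iff_rational_slopes:
  fixes f :: "real \<Rightarrow> real"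
  shows "f differentiable (at x) \<longleftrightarrow>
    (\<forall>n::nat. \<exists>k::nat. \<exists>q\<in>\<rat>. \<forall>y. \<bar>y - x\<bar> < 1 / Suc k \<longrightarrow>
       \<bar>f y - f x - q * (y - x)\<bar> \<le> \<bar>y - x\<bar> / Suc n)"
    (is "_ \<longleftrightarrow> (\<forall>n. \<exists>k. \<exists>q\<in>\<rat>. ?P n k q)")
proof
  assume "f differentiable (at x)"
  then obtain D where D: "(f has_derivative (\<lambda>h. D * h)) (at x)"
    by (metis has_field_derivative_def real_differentiable_def)
  show "\<forall>n. \<exists>k. \<exists>q\<in>\<rat>. ?P n k q"
  proof
    fix n :: nat
    \<comment> \<open>Half of the tolerance \<open>1 / Suc n\<close> goes to the approximation by
      \<open>D\<close>, the other half to replacing \<open>D\<close> by a rational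
      \<open>q\<close>.\<close>
    define e where "e = 1 / real (Suc n) / 2"
    have e: "e > 0" and e2: "2 * e = 1 / Suc n" by (simp_all add: e_def field_simps)
    obtain d where d: "d > 0"
      and dd: "\<And>y. \<bar>y - x\<bar> < d \<Longrightarrow> \<bar>f y - f x - D * (y - x)\<bar> \<le> e * \<bar>y - x\<bar>"
      using D e unfolding has_derivative_at_alt by (metis real_norm_def)
    obtain k where k: "1 / real (Suc k) < d"
      using d reals_Archimedean[of d] by (auto simp: inverse_eq_divide)
    obtain q where q: "q \<in> \<rat>" "D < q" "q < D + e"
      using Rats_dense_in_real[of D "D + e"] e by auto
    have "?P n k q"
    proof safe
      fix y assume y: "\<bar>y - x\<bar> < 1 / Suc k"
      have "\<bar>f y - f x - q * (y - x)\<bar> \<le> \<bar>f y - f x - D * (y - x)\<bar> + \<bar>(D - q) * (y - x)\<bar>"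
        by (rule order_trans[OF _ abs_triangle_ineq]) (simp add: algebra_simps)
      also have "\<dots> \<le> e * \<bar>y - x\<bar> + e * \<bar>y - x\<bar>"
        unfolding abs_mult using dd[of y] y k q by (intro add_mono mult_right_mono) auto
      finally show "\<bar>f y - f x - q * (y - x)\<bar> \<le> \<bar>y - x\<bar> / Suc n"
        using e2 by (simp flip: mult_2 add: mult.assoc[symmetric])
    qed
    then show "\<exists>k. \<exists>q\<in>\<rat>. ?P n k q" using q by blast
  qed
next
  assume "\<forall>n. \<exists>k. \<exists>q\<in>\<rat>. ?P n k q"
  then obtain k q where kq: "\<And>n. ?P n (k n) (q n)" by metis
  \<comment> \<open>Both slopes are tested at one common point \<open>x + h\<close> lying within
    both radii.\<close>
  have diff: "\<bar>q m - q n\<bar> \<le> 1 / Suc m + 1 / Suc n" for m n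
  proof -
    define h where "h = min (1 / real (Suc (k m))) (1 / real (Suc (k n))) / 2"
    have h: "h > 0" "h < 1 / real (Suc (k m))" "h < 1 / real (Suc (k n))"
      by (auto simp: h_def min_def field_simps)
    have "\<bar>f (x + h) - f x - q m * h\<bar> \<le> h / Suc m" "\<bar>f (x + h) - f x - q n * h\<bar> \<le> h / Suc n"
      using kq[of m] kq[of n] h by (force dest: spec[of _ "x + h"])+
    then have "\<bar>(q m - q n) * h\<bar> \<le> h / Suc m + h / Suc n"
      by (simp add: algebra_simps)
    then have "\<bar>q m - q n\<bar> * h \<le> (1 / Suc m + 1 / Suc n) * h"
      using h by (simp add: abs_mult distrib_right)
    then show ?thesis using h by simp
  qed
  have "Cauchy q"
  proof (rule metric_CauchyI)
    fix e :: real assume "e > 0"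
    then obtain M where M: "1 / real (Suc M) < e / 2"
      using reals_Archimedean[of "e / 2"] by (auto simp: inverse_eq_divide)
    have "dist (q m) (q n) < e" if "m \<ge> M" "n \<ge> M" for m n
    proof -
      have "1 / real (Suc m) \<le> 1 / real (Suc M)" "1 / real (Suc n) \<le> 1 / real (Suc M)"
        using that by (auto simp: field_simps)
      then show ?thesis using diff[of m n] M by (simp add: dist_real_def)
    qed
    then show "\<exists>M. \<forall>m\<ge>M. \<forall>n\<ge>M. dist (q m) (q n) < e" by blast
  qed
  then obtain L where L: "q \<longlonglongrightarrow> L" by (metis Cauchy_convergent convergentD)
  \<comment> \<open>Letting \<open>m\<close> tend to infinity in \<open>diff\<close> gives an
    explicit rate of convergence.\<close>
  have qL: "\<bar>q n - L\<bar> \<le> 1 / Suc n" for n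
  proof (rule LIMSEQ_le)
    show "(\<lambda>m. \<bar>q n - q m\<bar>) \<longlonglongrightarrow> \<bar>q n - L\<bar>" by (intro tendsto_intros L)
    have "(\<lambda>m. 1 / real (Suc n) + 1 / real (Suc m)) \<longlonglongrightarrow> 1 / real (Suc n) + 0"
      by (intro tendsto_intros LIMSEQ_Suc lim_1_over_n)
    then show "(\<lambda>m. 1 / real (Suc n) + 1 / real (Suc m)) \<longlonglongrightarrow> 1 / real (Suc n)" by simp
  qed (use diff in blast)
  have "(f has_derivative (\<lambda>h. L * h)) (at x)"
    unfolding has_derivative_at_alt
  proof (intro conjI allI impI)
    show "bounded_linear ((*) L)" by (rule bounded_linear_mult_right)
    fix e :: real assume "e > 0"
    then obtain n where n: "1 / real (Suc n) < e / 2"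
      using reals_Archimedean[of "e / 2"] by (auto simp: inverse_eq_divide)
    have "norm (f y - f x - L * (y - x)) \<le> e * norm (y - x)" if "norm (y - x) < 1 / Suc (k n)" for y
    proof -
      have "\<bar>f y - f x - L * (y - x)\<bar> \<le> \<bar>f y - f x - q n * (y - x)\<bar> + \<bar>(q n - L) * (y - x)\<bar>"
        by (rule order_trans[OF _ abs_triangle_ineq]) (simp add: algebra_simps)
      also have "\<dots> \<le> 1 / Suc n * \<bar>y - x\<bar> + 1 / Suc n * \<bar>y - x\<bar>"
        unfolding abs_mult using kq[of n] that qL[of n] by (intro add_mono mult_right_mono) auto
      also have "\<dots> = (1 / Suc n + 1 / Suc n) * \<bar>y - x\<bar>" by (simp add: algebra_simps)
      also have "\<dots> \<le> e * \<bar>y - x\<bar>" using n by (intro mult_right_mono) auto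
      finally show ?thesis by simp
    qed
    then show "\<exists>d>0. \<forall>y. norm (y - x) < d \<longrightarrow> norm (f y - f x - L * (y - x)) \<le> e * norm (y - x)"
      by (intro exI[of _ "1 / Suc (k n)"]) auto
  qed
  then show "f differentiable (at x)" unfolding differentiable_def by blast
qed

text \<open>Nothing is assumed about \<open>f\<close>. Its continuity points form a Borel set
  \<open>C\<close>, differentiability forces a point into \<open>C\<close>, and each condition
  \<open>G n k q\<close> is closed relative to \<open>C\<close>.\<close>

lemma differentiable_points_borel:
  fixes f :: "real \<Rightarrow> real"
  shows "{x. f differentiable (at x)} \<in> sets borel"
proof -
  define C where "C = {x. isCont f x}"
  define G where "G n k q = {x. \<forall>y. \<bar>y - x\<bar> < 1 / Suc k \<longrightarrow>
       \<bar>f y - f x - q * (y - x)\<bar> \<le> \<bar>y - x\<bar> / Suc n}" for n k :: nat and q :: real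
  have C: "C \<in> sets borel" by (simp add: C_def)
  have "C \<inter> G n k q \<in> sets borel" for n k q
  proof -
    \<comment> \<open>Continuity at the limit point \<open>x\<close> gives convergence of
      \<open>f (u i)\<close> to \<open>f x\<close>, so the inequality survives the limit; the strict
      bound on \<open>y\<close> holds eventually for \<open>u i\<close> in place of
      \<open>x\<close>.\<close>
    have "x \<in> G n k q" if x: "x \<in> C" "x \<in> closure (C \<inter> G n k q)" for x
    proof -
      obtain u where u: "\<And>i. u i \<in> C \<inter> G n k q" "u \<longlonglongrightarrow> x"
        using x closure_sequential by metis
      have fu: "(\<lambda>i. f (u i)) \<longlonglongrightarrow> f x"
        using x u by (auto simp: C_def intro: isCont_tendsto_compose)
      show ?thesis unfolding G_def
      proof (safe)
        fix y assume y: "\<bar>y - x\<bar> < 1 / Suc k"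
        have "(\<lambda>i. \<bar>y - u i\<bar>) \<longlonglongrightarrow> \<bar>y - x\<bar>" by (intro tendsto_intros u)
        then have ev: "\<forall>\<^sub>F i in sequentially. \<bar>y - u i\<bar> < 1 / Suc k"
          using y by (rule order_tendstoD)
        show "\<bar>f y - f x - q * (y - x)\<bar> \<le> \<bar>y - x\<bar> / Suc n"
        proof (rule tendsto_le)
          show "(\<lambda>i. \<bar>y - u i\<bar> / Suc n) \<longlonglongrightarrow> \<bar>y - x\<bar> / Suc n"
            by (intro tendsto_intros u) auto
          show "(\<lambda>i. \<bar>f y - f (u i) - q * (y - u i)\<bar>) \<longlonglongrightarrow> \<bar>f y - f x - q * (y - x)\<bar>"
            by (intro tendsto_intros u fu)
          show "\<forall>\<^sub>F i in sequentially. \<bar>f y - f (u i) - q * (y - u i)\<bar> \<le> \<bar>y - u i\<bar> / Suc n"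
            using ev by eventually_elim (use u in \<open>auto simp: G_def\<close>)
        qed simp
      qed
    qed
    then have "C \<inter> G n k q = C \<inter> closure (C \<inter> G n k q)"
      using closure_subset by blast
    then show ?thesis using C by (metis borel_closed closed_closure sets.Int)
  qed
  then have "(\<Inter>n. \<Union>k. \<Union>q\<in>\<rat>. C \<inter> G n k q) \<in> sets borel"
    by (intro sets.countable_INT'' sets.countable_UN' sets.countable_UN'' countable_rat) auto
  moreover have "{x. f differentiable (at x)} = (\<Inter>n. \<Union>k. \<Union>q\<in>\<rat>. C \<inter> G n k q)"
  proof -
    have "x \<in> C" if "f differentiable (at x)" for x
      using that by (simp add: C_def differentiable_imp_continuous_within)
    then show ?thesis
      unfolding G_def by (auto simp: differentiable_iff_rational_slopes)
  qed
  ultimately show ?thesis by simp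
qed

text \<open>Wherever a function is not differentiable, \<^const>\<open>deriv\<close> returns one and the same arbitrary
  value, so that the equation forces \<open>f\<close> to agree there with one of two explicit functions.\<close>

lemma borel_measurable_if_formal_ode:
  fixes f a b g :: "real \<Rightarrow> real"
  assumes ode: "\<And>x. a x * deriv (deriv f) x + b x * deriv f x + g x * f x = 0"
    and [measurable]: "a \<in> borel_measurable borel" "b \<in> borel_measurable borel" "g \<in> borel_measurable borel"
    and zeros: "countable {x. g x = 0}"
  shows "f \<in> borel_measurable borel"
proof -
  define K :: real where "K = (SOME D. False)"
  have K: "deriv h x = K" if "\<not> h differentiable (at x)" for h :: "real \<Rightarrow> real" and x
    using that unfolding deriv_def K_def real_differentiable_def by simp
  define D where "D = {x. f differentiable (at x)}"
  define D1 where "D1 = {x. deriv f differentiable (at x)}"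
  have [measurable]: "D \<in> sets borel" "D1 \<in> sets borel"
    unfolding D_def D1_def by (rule differentiable_points_borel)+
  define h where "h x = (if x \<in> D then f x
      else if x \<in> D1 then - b x * K / g x else - (a x * K + b x * K) / g x)" for x
  \<comment> \<open>Discarded are the zeros of \<open>g\<close>, where the equation cannot be solved
    for \<open>f x\<close>, and the isolated points of \<open>- D\<close>, where no sequence in
    \<open>- D\<close> approaches \<open>x\<close>.\<close>
  define X where "X = {x. g x = 0} \<union> {x \<in> - D. \<not> x islimpt - D}"
  have X: "countable X"
    unfolding X_def using zeros countable_isolated_points by blast
  have "continuous_on D f"
    unfolding D_def by (auto intro!: continuous_at_imp_continuous_on differentiable_imp_continuous_within)
  then have fD: "f \<in> borel_measurable (restrict_space borel D)"
    by (rule borel_measurable_continuous_on_restrict)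
  have h: "h \<in> borel_measurable borel"
    unfolding h_def
  proof (subst measurable_If_restrict_space_iff)
    show "f \<in> borel_measurable (restrict_space borel {x. x \<in> D}) \<and>
      (\<lambda>x. if x \<in> D1 then - b x * K / g x else - (a x * K + b x * K) / g x)
        \<in> borel_measurable (restrict_space borel {x. x \<notin> D})"
      using fD by (auto intro!: measurable_restrict_space1)
  qed auto
  have eq: "h x = f x" if x: "x \<notin> X" for x
  proof (cases "x \<in> D")
    case False
    then have d1: "deriv f x = K" using K by (simp add: D_def)
    have g: "g x \<noteq> 0" and lim: "x islimpt - D" using x False by (auto simp: X_def)
    \<comment> \<open>\<open>deriv f\<close> equals \<open>K\<close> at \<open>x\<close> and at
      points of \<open>- D\<close> accumulating at \<open>x\<close>, so a derivative of
      \<open>deriv f\<close> at \<open>x\<close> can only be 0. If there is none, the outer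
      \<open>deriv\<close> is the default \<open>K\<close> again.\<close>
    have "deriv (deriv f) x = (if x \<in> D1 then 0 else K)"
    proof (cases "x \<in> D1")
      case True
      then obtain L where L: "(deriv f has_real_derivative L) (at x)"
        by (auto simp: D1_def real_differentiable_def)
      obtain u where u: "\<And>i. u i \<in> - D - {x}" "u \<longlonglongrightarrow> x"
        using lim islimpt_sequential by metis
      have "((\<lambda>y. (deriv f y - deriv f x) / (y - x)) \<longlongrightarrow> L) (at x)"
        using L by (simp add: has_field_derivative_iff)
      then have "(\<lambda>i. (deriv f (u i) - deriv f x) / (u i - x)) \<longlonglongrightarrow> L"
        by (rule filterlim_compose) (use u in \<open>auto simp: filterlim_at\<close>)
      moreover have "deriv f (u i) = K" for i
        using u(1)[of i] K by (auto simp: D_def)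
      ultimately have "(\<lambda>i. 0) \<longlonglongrightarrow> L" using d1 by simp
      then have "L = 0" by (simp add: LIMSEQ_const_iff)
      then show ?thesis using True L DERIV_imp_deriv by auto
    qed (simp add: K D1_def)
    then show ?thesis
      using ode[of x] d1 g False by (auto simp: h_def field_simps)
  qed (simp add: h_def)
  show ?thesis
    by (rule measurable_discrete_difference[OF h X]) (use eq in auto)
qed

subsection \<open>The finite Fourier transform\<close>

lemma absolutely_integrable_mult_continuous:
  fixes \<phi> :: "real \<Rightarrow> real" and g :: "real \<Rightarrow> complex"
  assumes \<phi>: "\<phi> absolutely_integrable_on {a..b}" and g: "continuous_on {a..b} g"
  shows "(\<lambda>t. of_real (\<phi> t) * g t) absolutely_integrable_on {a..b}"
proof -
  have "bounded (g ` {a..b})"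
    using compact_continuous_image[OF g] compact_imp_bounded by blast
  moreover have "g \<in> borel_measurable (lebesgue_on {a..b})"
    using g by (intro continuous_imp_measurable_on_sets_lebesgue) auto
  ultimately have "(\<lambda>t. g t * of_real (\<phi> t)) absolutely_integrable_on {a..b}"
    using \<phi>
    by (intro absolutely_integrable_bounded_measurable_product[where h = "(*)"])
       (auto intro!: bilinear_times absolutely_integrable_linear[OF _ bounded_linear_of_real, unfolded o_def])
  then show ?thesis by (simp add: mult.commute)
qed

text \<open>The test function is \<open>arctan (\<phi> t)\<close>: it is bounded and has the sign of
  \<open>\<phi> t\<close>, so the product is nonnegative and vanishes only where
  \<open>\<phi>\<close> does. It need not be continuous, but it is almost everywhere a limit of the
  continuous \<open>arctan (g n t)\<close>.\<close>

lemma negligible_support_if_orthogonal_to_continuous: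
  fixes \<phi> :: "real \<Rightarrow> real"
  assumes \<phi>: "\<phi> absolutely_integrable_on {a..b}"
    and orth: "\<And>g. continuous_on {a..b} g \<Longrightarrow> integral {a..b} (\<lambda>t. \<phi> t * g t) = 0"
  shows "negligible {t \<in> {a..b}. \<phi> t \<noteq> 0}"
proof -
  have meas: "\<phi> \<in> borel_measurable (lebesgue_on {a..b})"
    using \<phi> by (simp add: absolutely_integrable_measurable)
  then have "\<phi> measurable_on {a..b}"
    by (simp add: measurable_on_iff_borel_measurable)
  then obtain N g where N: "negligible N" and g: "\<And>n. continuous_on UNIV (g n)"
    and lim: "\<And>x. x \<notin> N \<Longrightarrow> (\<lambda>n. g n x) \<longlonglongrightarrow> (if x \<in> {a..b} then \<phi> x else 0)"
    unfolding measurable_on_def by blast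
  \<comment> \<open>Removing the null set \<open>N\<close> makes the convergence hold at every
    point, while integrals over \<open>S\<close> and \<open>{a..b}\<close> agree.\<close>
  define S where "S = {a..b} - N"
  have sub: "negligible {x \<in> {a..b} - S. f x \<noteq> 0}" for f :: "real \<Rightarrow> real"
    by (rule negligible_subset[OF N]) (auto simp: S_def)
  have sub': "negligible {x \<in> S - {a..b}. f x \<noteq> 0}" for f :: "real \<Rightarrow> real"
  proof -
    have "{x \<in> S - {a..b}. f x \<noteq> 0} = {}" by (auto simp: S_def)
    then show ?thesis by (simp only: negligible_empty)
  qed
  have int_S: "f integrable_on {a..b} \<longleftrightarrow> f integrable_on S" for f :: "real \<Rightarrow> real"
    by (auto intro: integrable_spike_set[OF _ sub sub'] integrable_spike_set[OF _ sub' sub])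
  have integral_S: "integral {a..b} f = integral S f" for f :: "real \<Rightarrow> real"
    by (intro integral_spike_set sub sub')
  have ia: "(\<lambda>t. \<phi> t * h t) absolutely_integrable_on {a..b}"
    if "h \<in> borel_measurable (lebesgue_on {a..b})" "bounded (h ` {a..b})" for h :: "real \<Rightarrow> real"
    using absolutely_integrable_bounded_measurable_product[OF bilinear_times that(1) _ that(2) \<phi>]
    by (simp add: mult.commute)
  have abs_arctan: "\<bar>arctan y\<bar> \<le> pi / 2" for y
    using arctan_bounded[of y] by auto
  have bd: "bounded ((\<lambda>t. arctan (h t)) ` {a..b})" for h
    by (rule boundedI[of _ "pi / 2"]) (use abs_arctan in auto)
  have at_cont: "continuous_on A (\<lambda>t. arctan (g n t))" for A n
    by (intro continuous_intros continuous_on_subset[OF g]) auto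
  have I: "(\<lambda>t. \<phi> t * arctan (\<phi> t)) absolutely_integrable_on {a..b}"
    using meas bd by (intro ia) auto
  have "(\<lambda>n. integral S (\<lambda>t. \<phi> t * arctan (g n t))) \<longlonglongrightarrow> integral S (\<lambda>t. \<phi> t * arctan (\<phi> t))"
  proof (rule dominated_convergence(2))
    show "(\<lambda>t. \<phi> t * arctan (g n t)) integrable_on S" for n
      unfolding int_S[symmetric]
      using bd at_cont[of "{a..b}" n]
      by (intro set_lebesgue_integral_eq_integral(1) ia continuous_imp_measurable_on_sets_lebesgue) auto
    have "(\<lambda>t. \<bar>\<phi> t\<bar> * (pi / 2)) integrable_on {a..b}"
      using \<phi> by (intro integrable_on_mult_left) (auto simp: absolutely_integrable_on_def)
    then show "(\<lambda>t. \<bar>\<phi> t\<bar> * (pi / 2)) integrable_on S" by (simp only: int_S)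
    show "norm (\<phi> t * arctan (g n t)) \<le> \<bar>\<phi> t\<bar> * (pi / 2)" for n t
      unfolding real_norm_def abs_mult using abs_arctan by (intro mult_left_mono) auto
    show "(\<lambda>n. \<phi> t * arctan (g n t)) \<longlonglongrightarrow> \<phi> t * arctan (\<phi> t)" if "t \<in> S" for t
      using lim[of t] that by (auto simp: S_def intro!: tendsto_intros)
  qed
  moreover have "integral S (\<lambda>t. \<phi> t * arctan (g n t)) = 0" for n
    unfolding integral_S[symmetric] by (rule orth[OF at_cont])
  ultimately have "integral {a..b} (\<lambda>t. \<phi> t * arctan (\<phi> t)) = 0"
    by (simp add: integral_S LIMSEQ_const_iff)
  moreover have nonneg: "\<phi> t * arctan (\<phi> t) \<ge> 0" for t
    by (cases "\<phi> t \<ge> 0") (auto intro: mult_nonneg_nonneg mult_nonpos_nonpos)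
  ultimately have "AE t in lebesgue. indicator {a..b} t *\<^sub>R (\<phi> t * arctan (\<phi> t)) = 0"
    using I set_lebesgue_integral_eq_integral(2)[OF I]
    unfolding set_integrable_def set_lebesgue_integral_def
    by (subst integral_nonneg_eq_0_iff_AE[symmetric]) (auto simp: indicator_def)
  then obtain M where M: "negligible M"
    "{t. \<not> indicator {a..b} t *\<^sub>R (\<phi> t * arctan (\<phi> t)) = 0} \<subseteq> M"
    unfolding eventually_ae_filter_negligible by blast
  show ?thesis by (rule negligible_subset[OF M(1)]) (use M(2) in \<open>auto simp: indicator_def\<close>)
qed

text \<open>The functions whose multiplication operator preserves the annihilator of the exponentials form
  an algebra; it contains \<open>sin\<close>, which shifts frequencies and separates points.\<close>

lemma negligible_support_if_fourier_zero:
  fixes \<phi> :: "real \<Rightarrow> real"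
  assumes \<phi>: "\<phi> absolutely_integrable_on {-1..1}"
    and zero: "\<And>w. integral {-1..1} (\<lambda>t. of_real (\<phi> t) * exp (\<i> * of_real (w * t))) = 0"
  shows "negligible {t \<in> {-1..1}. \<phi> t \<noteq> 0}"
proof (rule negligible_support_if_orthogonal_to_continuous[OF \<phi>])
  \<comment> \<open>All frequencies \<open>w\<close> are demanded, not only 0, so that
    multiplication by \<open>sin\<close>, which brings in \<open>w + 1\<close> and
    \<open>w - 1\<close>, stays within \<open>V\<close>.\<close>
  define V where "V g \<longleftrightarrow> continuous_on {-1..1} g \<and>
      (\<forall>w. integral {-1..1} (\<lambda>t. of_real (\<phi> t) * (of_real (g t) * exp (\<i> * of_real (w * t)))) = 0)"
    for g :: "real \<Rightarrow> real"
  define R where "R f \<longleftrightarrow> continuous_on {-1..1} f \<and> (\<forall>g. V g \<longrightarrow> V (\<lambda>t. f t * g t))"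
    for f :: "real \<Rightarrow> real"
  have int: "(\<lambda>t. of_real (\<phi> t) * g t) integrable_on {-1..1}"
    if "continuous_on {-1..1} g" for g :: "real \<Rightarrow> complex"
    by (rule set_lebesgue_integral_eq_integral(1)[OF absolutely_integrable_mult_continuous[OF \<phi> that]])
  have V1: "V (\<lambda>t. 1)" using zero by (simp add: V_def)
  have Vadd: "V (\<lambda>t. f t + g t)" if "V f" "V g" for f g
  proof -
    have "integral {-1..1} (\<lambda>t. of_real (\<phi> t) * (of_real (f t + g t) * exp (\<i> * of_real (w * t)))) =
      integral {-1..1} (\<lambda>t. of_real (\<phi> t) * (of_real (f t) * exp (\<i> * of_real (w * t)))) +
      integral {-1..1} (\<lambda>t. of_real (\<phi> t) * (of_real (g t) * exp (\<i> * of_real (w * t))))" for w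
      using that unfolding V_def
      by (subst integral_add[symmetric]) (auto simp: algebra_simps intro!: int continuous_intros)
    then show ?thesis using that by (auto simp: V_def intro!: continuous_intros)
  qed
  have Vcmul: "V (\<lambda>t. k * g t)" if "V g" for g k
  proof -
    have "(\<lambda>t. of_real (\<phi> t) * (of_real (k * g t) * exp (\<i> * of_real (w * t)))) =
      (\<lambda>t. of_real k * (of_real (\<phi> t) * (of_real (g t) * exp (\<i> * of_real (w * t)))))" for w
      by (auto simp: algebra_simps)
    then show ?thesis using that by (auto simp: V_def intro!: continuous_intros)
  qed
  have Rsin: "R sin"
    unfolding R_def
  proof (intro conjI allI impI)
    fix g assume g: "V g"
    then have cg: "continuous_on {-1..1} g" by (simp add: V_def)
    let ?J = "\<lambda>w t. of_real (\<phi> t) * (of_real (g t) * exp (\<i> * of_real (w * t)))"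
    have eq: "of_real (\<phi> t) * (of_real (sin t * g t) * exp (\<i> * of_real (w * t))) =
        (?J (w + 1) t - ?J (w - 1) t) * (1 / (2 * \<i>))" for w t
    proof -
      have shift: "exp (\<i> * of_real ((w + 1) * t)) = exp (\<i> * of_real (w * t)) * exp (\<i> * of_real t)"
        "exp (\<i> * of_real ((w - 1) * t)) = exp (\<i> * of_real (w * t)) * exp (- (\<i> * of_real t))"
        by (simp_all add: exp_add[symmetric] algebra_simps)
      have sin: "of_real (sin t) = (exp (\<i> * of_real t) - exp (- (\<i> * of_real t))) / (2 * \<i>)"
        by (simp add: sin_of_real[symmetric] sin_exp_eq)
      show ?thesis
        unfolding shift of_real_mult[of "sin t"] sin by (simp add: algebra_simps diff_divide_distrib)
    qed
    have "integral {-1..1} (\<lambda>t. (?J (w + 1) t - ?J (w - 1) t) * (1 / (2 * \<i>))) = 0" for w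
    proof -
      have "?J v integrable_on {-1..1}" for v by (intro int continuous_intros cg)
      moreover have "integral {-1..1} (?J v) = 0" for v using g unfolding V_def by blast
      ultimately show ?thesis by (simp only: integral_mult_left integral_diff) simp
    qed
    then show "V (\<lambda>t. sin t * g t)"
      unfolding V_def eq by (auto intro!: continuous_intros cg)
  qed (intro continuous_intros)
  fix g :: "real \<Rightarrow> real" assume g: "continuous_on {-1..1} g"
  define B where "B = integral {-1..1} (\<lambda>t. \<bar>\<phi> t\<bar>)"
  have intr: "(\<lambda>t. \<phi> t * h t) integrable_on {-1..1}" if "continuous_on {-1..1} h" for h
  proof -
    have "(\<lambda>t. Re (of_real (\<phi> t) * of_real (h t))) integrable_on {-1..1}"
      by (rule integrable_linear[OF int bounded_linear_Re, unfolded o_def])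
         (intro continuous_intros that)
    then show ?thesis by simp
  qed
  have B: "(\<lambda>t. \<bar>\<phi> t\<bar>) integrable_on {-1..1}" "B \<ge> 0"
    using \<phi> unfolding B_def by (auto simp: absolutely_integrable_on_def intro!: integral_nonneg)
  have bound: "\<bar>integral {-1..1} (\<lambda>t. \<phi> t * g t)\<bar> \<le> B * e" if e: "e > 0" for e
  proof -
    \<comment> \<open>\<open>R\<close> is closed under products because multiplication operators
      compose, so Stone-Weierstrass applies to it.\<close>
    have "\<exists>f. R f \<and> (\<forall>x\<in>{-1..1}. \<bar>g x - f x\<bar> < e)"
    proof (rule Stone_Weierstrass_HOL[OF _ _ _ _ _ _ g e])
      show "R (\<lambda>x. k)" for k using Vcmul by (auto simp: R_def)
      show "\<And>f. R f \<Longrightarrow> continuous_on {-1..1} f" by (simp add: R_def)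
      show "\<And>f g. R f \<and> R g \<Longrightarrow> R (\<lambda>x. f x + g x)"
        using Vadd by (auto simp: R_def distrib_right intro!: continuous_intros)
      show "\<And>f g. R f \<and> R g \<Longrightarrow> R (\<lambda>x. f x * g x)"
        by (auto simp: R_def mult.assoc intro!: continuous_intros)
      fix x y :: real assume xy: "x \<in> {-1..1} \<and> y \<in> {-1..1} \<and> x \<noteq> y"
      \<comment> \<open>\<open>sin\<close> is injective on \<open>[-1,1]\<close> because 1 is below
        \<open>pi / 2\<close>.\<close>
      have "- (pi / 2) \<le> x" "x \<le> pi / 2" "- (pi / 2) \<le> y" "y \<le> pi / 2"
        using xy pi_ge_two by auto
      then have "sin x \<noteq> sin y" using xy sin_inj_pi[of x y] by blast
      then show "\<exists>f. R f \<and> f x \<noteq> f y" using Rsin by blast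
    qed auto
    then obtain f where f: "R f" "\<And>x. x \<in> {-1..1} \<Longrightarrow> \<bar>g x - f x\<bar> < e" by blast
    have cf: "continuous_on {-1..1} f" using f by (simp add: R_def)
    \<comment> \<open>Applying the multiplier \<open>f\<close> to the constant 1 and taking
      frequency 0 shows that \<open>\<phi>\<close> is orthogonal to \<open>f\<close>.\<close>
    have "V (\<lambda>t. f t * 1)" using f V1 by (simp only: R_def)
    then have "integral {-1..1} (\<lambda>t. of_real (\<phi> t) * (of_real (f t) * exp (\<i> * of_real (0 * t)))) = 0"
      unfolding V_def mult_1_right by blast
    then have "complex_of_real (integral {-1..1} (\<lambda>t. \<phi> t * f t)) = 0"
      using integral_linear[OF intr[OF cf] bounded_linear_of_real[where 'a=complex]] by (simp add: o_def)
    then have "integral {-1..1} (\<lambda>t. \<phi> t * g t) = integral {-1..1} (\<lambda>t. \<phi> t * g t - \<phi> t * f t)"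
      using integral_diff[OF intr[OF g] intr[OF cf]] by simp
    also have "\<bar>\<dots>\<bar> \<le> integral {-1..1} (\<lambda>t. \<bar>\<phi> t\<bar> * e)"
      unfolding real_norm_def[symmetric]
    proof (rule integral_norm_bound_integral)
      show "(\<lambda>t. \<phi> t * g t - \<phi> t * f t) integrable_on {-1..1}"
        by (intro integrable_diff intr g cf)
      show "(\<lambda>t. norm (\<phi> t) * e) integrable_on {-1..1}"
        using B by (intro integrable_on_mult_left) auto
      show "norm (\<phi> t * g t - \<phi> t * f t) \<le> norm (\<phi> t) * e" if "t \<in> {-1..1}" for t
        unfolding right_diff_distrib[symmetric] norm_mult
        using f(2)[OF that] by (intro mult_left_mono) auto
    qed
    finally show ?thesis by (simp add: B_def)
  qed
  show "integral {-1..1} (\<lambda>t. \<phi> t * g t) = 0"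
  proof (rule ccontr)
    assume n0: "integral {-1..1} (\<lambda>t. \<phi> t * g t) \<noteq> 0" (is "?I \<noteq> 0")
    \<comment> \<open>The denominator \<open>2 * (B + 1)\<close> is positive even if
      \<open>B = 0\<close>, and \<open>B / (2 * (B + 1))\<close> is below 1.\<close>
    have "\<bar>?I\<bar> \<le> B * (\<bar>?I\<bar> / (2 * (B + 1)))" using n0 B by (intro bound) auto
    also have "\<dots> = \<bar>?I\<bar> * (B / (2 * (B + 1)))" by simp
    also have "\<dots> < \<bar>?I\<bar> * 1"
      using n0 B by (intro mult_strict_left_mono) auto
    finally show False by simp
  qed
qed

text \<open>The integrands are dominated by the modulus of \<open>\<phi>\<close>. Asking only for
  integrability lets the eigenvalue equation upgrade an integrable eigenfunction to a continuous
  one.\<close>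

lemma continuous_fin_fourier:
  assumes \<phi>: "\<phi> absolutely_integrable_on {-1..1}"
  shows "continuous_on UNIV (fin_fourier c \<phi>)"
  unfolding continuous_on_sequentially comp_def
proof safe
  fix u :: "nat \<Rightarrow> real" and x assume u: "u \<longlonglongrightarrow> x"
  show "(\<lambda>n. fin_fourier c \<phi> (u n)) \<longlonglongrightarrow> fin_fourier c \<phi> x"
    unfolding fin_fourier_def
  proof (rule dominated_convergence(2))
    show "(\<lambda>t. complex_of_real (\<phi> t) * exp (\<i> * complex_of_real (c * u n * t))) integrable_on {-1..1}" for n
      by (intro set_lebesgue_integral_eq_integral(1) absolutely_integrable_mult_continuous \<phi> continuous_intros)
    show "(\<lambda>t. \<bar>\<phi> t\<bar>) integrable_on {-1..1}"
      using \<phi> by (auto simp: absolutely_integrable_on_def)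
    show "(\<lambda>n. complex_of_real (\<phi> t) * exp (\<i> * complex_of_real (c * u n * t)))
        \<longlonglongrightarrow> complex_of_real (\<phi> t) * exp (\<i> * complex_of_real (c * x * t))" for t
      by (intro tendsto_intros u)
  qed (simp add: norm_mult)
qed

text \<open>The kernel is entire in \<open>z\<close>, so differentiation under the integral over a
  compact interval applies.\<close>

lemma holomorphic_fin_fourier_extension:
  assumes "continuous_on {-1..1} \<phi>"
  shows "(\<lambda>z. integral {-1..1} (\<lambda>t. complex_of_real (\<phi> t) * exp (\<i> * (of_real c * z * of_real t))))
    holomorphic_on UNIV"
proof -
  have [continuous_intros]: "continuous_on {-1..1} (\<lambda>t. complex_of_real (\<phi> t))"
    by (intro continuous_intros assms)
  have [continuous_intros]: "continuous_on (UNIV \<times> {-1..1}) (\<lambda>p. complex_of_real (\<phi> (snd p)))"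
    by (rule continuous_on_compose2[OF \<open>continuous_on {-1..1} (\<lambda>t. complex_of_real (\<phi> t))\<close>])
       (auto intro!: continuous_intros)
  have "(\<lambda>z. integral (cbox (-1) 1) (\<lambda>t. complex_of_real (\<phi> t) * exp (\<i> * (of_real c * z * of_real t))))
    holomorphic_on UNIV"
  proof (rule leibniz_rule_holomorphic)
    fix z t
    show "((\<lambda>z. complex_of_real (\<phi> t) * exp (\<i> * (of_real c * z * of_real t))) has_field_derivative
      complex_of_real (\<phi> t) * (exp (\<i> * (of_real c * z * of_real t)) * (\<i> * (of_real c * of_real t))))
      (at z within UNIV)"
      by (auto intro!: derivative_eq_intros)
    show "(\<lambda>t. complex_of_real (\<phi> t) * exp (\<i> * (of_real c * z * of_real t))) integrable_on cbox (-1) 1"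
      unfolding box_real by (intro integrable_continuous_interval continuous_intros)
  qed (auto simp: case_prod_unfold intro!: continuous_intros)
  then show ?thesis by simp
qed

text \<open>The complex derivative can be computed along the real axis, where \<open>H\<close> is
  real. The second conclusion makes \<open>deriv H\<close> an extension of \<open>deriv f\<close>,
  so the lemma can be iterated.\<close>

lemma has_real_derivative_of_holomorphic_extension:
  fixes f :: "real \<Rightarrow> real"
  assumes H: "H holomorphic_on UNIV" and ext: "\<And>x. H (of_real x) = of_real (f x)"
  shows "(f has_real_derivative deriv f x) (at x)" "deriv H (of_real x) = of_real (deriv f x)"
proof -
  have "(H has_field_derivative deriv H (of_real x)) (at (of_real x))"
    using H by (simp add: holomorphic_derivI)
  then have v: "((\<lambda>x. H (of_real x)) has_vector_derivative deriv H (of_real x)) (at x)"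
    by (rule has_vector_derivative_real_field)
  have "(f has_vector_derivative Re (deriv H (of_real x))) (at x)"
    using bounded_linear.has_vector_derivative[OF bounded_linear_Re v] by (simp add: ext)
  then have r: "(f has_real_derivative Re (deriv H (of_real x))) (at x)"
    by (simp add: has_real_derivative_iff_has_vector_derivative)
  have "((\<lambda>x. 0::real) has_vector_derivative Im (deriv H (of_real x))) (at x)"
    using bounded_linear.has_vector_derivative[OF bounded_linear_Im v] by (simp add: ext)
  then have i: "Im (deriv H (of_real x)) = 0"
    using vector_derivative_unique_at has_vector_derivative_const by blast
  from r have d: "deriv f x = Re (deriv H (of_real x))" by (rule DERIV_imp_deriv)
  show "(f has_real_derivative deriv f x) (at x)" using r d by simp
  show "deriv H (of_real x) = of_real (deriv f x)" using i d by (simp add: complex_eq_iff)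
qed

subsection \<open>Monotonicity\<close>

text \<open>A nondecreasing \<open>F\<close> with equal values at \<open>a\<close> and
  \<open>b\<close> is constant between them, which would force \<open>G\<close> to vanish
  there.\<close>

lemma strict_mono_on_if_deriv_nonneg:
  fixes F G :: "real \<Rightarrow> real"
  assumes deriv: "\<And>t. t > m \<Longrightarrow> (F has_real_derivative G t) (at t)"
    and nonneg: "\<And>t. t > m \<Longrightarrow> G t \<ge> 0"
    and nonzero: "\<And>a b. m < a \<Longrightarrow> a < b \<Longrightarrow> \<exists>t\<in>{a<..<b}. G t \<noteq> 0"
  shows "strict_mono_on {m<..} F"
proof (rule strict_mono_onI)
  have mono: "F s \<le> F t" if "m < s" "s \<le> t" for s t
  proof (rule DERIV_nonneg_imp_nondecreasing[of s t F])
    show "\<exists>y. (F has_real_derivative y) (at x) \<and> 0 \<le> y" if "s \<le> x" "x \<le> t" for x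
      using deriv[of x] nonneg[of x] that \<open>m < s\<close> by (intro exI[of _ "G x"]) auto
  qed (rule that(2))
  fix a b assume ab: "a \<in> {m<..}" "b \<in> {m<..}" "a < b"
  show "F a < F b"
  proof (rule ccontr)
    assume "\<not> F a < F b"
    then have const: "F t = F a" if "t \<in> {a<..<b}" for t
      using mono[of a t] mono[of t b] ab that by auto
    obtain t where t: "t \<in> {a<..<b}" "G t \<noteq> 0" using nonzero[of a b] ab by auto
    have "(F has_real_derivative 0) (at t)"
      by (rule has_field_derivative_transform_within_open[of "\<lambda>_. F a" _ _ "{a<..<b}"])
         (use t const in auto)
    then show False using deriv[of t] t ab DERIV_unique by fastforce
  qed
qed

section \<open>Derivatives of the two quantities, with \<open>f\<close>, \<open>g\<close>,
  \<open>h\<close> in the roles of the function and its first two derivatives\<close>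

context
  fixes c \<kappa> :: real and f g :: "real \<Rightarrow> real" and h :: "real \<Rightarrow> real"
  assumes c: "c > 0" and chi: "\<kappa> > 0"
    and f: "\<And>x. (f has_real_derivative g x) (at x)"
    and g: "\<And>x. (g has_real_derivative h x) (at x)"
    and ode: "\<And>x. (1 - x\<^sup>2) * h x - 2 * x * g x + (\<kappa> - c\<^sup>2 * x\<^sup>2) * f x = 0"
    and nonzero: "\<And>a b. a < b \<Longrightarrow> \<exists>t\<in>{a<..<b}. f t \<noteq> 0"
begin

lemma prolate_coefficients_pos:
  assumes "t > max (sqrt \<kappa> / c) 1"
  shows "t > 1" "t\<^sup>2 - 1 > 0" "c\<^sup>2 * t\<^sup>2 - \<kappa> > 0"
proof -
  show t: "t > 1" using assms by simp
  then show "t\<^sup>2 - 1 > 0" by (simp add: power2_eq_square less_1_mult)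
  have "sqrt \<kappa> < c * t" using assms c by (simp add: field_simps)
  then have "(sqrt \<kappa>)\<^sup>2 < (c * t)\<^sup>2" using chi by (intro power_strict_mono) auto
  then show "c\<^sup>2 * t\<^sup>2 - \<kappa> > 0" using chi by (simp add: power_mult_distrib)
qed

text \<open>If \<open>g\<close> vanished on an interval, so would \<open>h\<close>, and the equation
  with its positive coefficient would force \<open>f\<close> to vanish too. This gives strictness
  for \<open>Q\<close>, whose derivative carries the factor \<open>(g t)\<^sup>2\<close>.\<close>

lemma prolate_derivative_nonzero:
  assumes "max (sqrt \<kappa> / c) 1 < a" "a < b"
  shows "\<exists>t\<in>{a<..<b}. g t \<noteq> 0"
proof (rule ccontr)
  assume "\<not> ?thesis"
  then have g0: "g t = 0" if "t \<in> {a<..<b}" for t using that by auto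
  have "f t = 0" if t: "t \<in> {a<..<b}" for t
  proof -
    have "(g has_real_derivative 0) (at t)"
      by (rule has_field_derivative_transform_within_open[of "\<lambda>_. 0" _ _ "{a<..<b}"])
         (use t g0 in auto)
    then have "h t = 0" using g[of t] DERIV_unique by blast
    then show ?thesis
      using ode[of t] g0[OF t] prolate_coefficients_pos(3)[of t] t assms by auto
  qed
  then show False using nonzero[OF assms(2)] by blast
qed

lemma strict_antimono_prolate_Q:
  "strict_antimono_on {max (sqrt \<kappa> / c) 1<..} (\<lambda>t. (f t)\<^sup>2 + (t\<^sup>2 - 1) * (g t)\<^sup>2 / (c\<^sup>2 * t\<^sup>2 - \<kappa>))"
    (is "monotone_on ?S _ _ ?Q")
proof -
  let ?G = "\<lambda>t. 2 * t * (g t)\<^sup>2 / (c\<^sup>2 * t\<^sup>2 - \<kappa>) * (1 + c\<^sup>2 * (t\<^sup>2 - 1) / (c\<^sup>2 * t\<^sup>2 - \<kappa>))"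
  have "strict_mono_on ?S (\<lambda>t. - ?Q t)"
  proof (rule strict_mono_on_if_deriv_nonneg)
    fix t assume t: "t > max (sqrt \<kappa> / c) 1"
    note pos = prolate_coefficients_pos[OF t]
    define p where "p = t\<^sup>2 - 1"
    define q where "q = c\<^sup>2 * t\<^sup>2 - \<kappa>"
    have pq: "p > 0" "q > 0" using pos by (auto simp: p_def q_def)
    have d: "((\<lambda>t. - ?Q t) has_real_derivative
        - (2 * f t * g t + ((2 * t * (g t)\<^sup>2 + p * (2 * g t * h t)) * q - p * (g t)\<^sup>2 * (c\<^sup>2 * (2 * t))) / (q * q))) (at t)"
      using pq unfolding p_def q_def
      by (auto intro!: derivative_eq_intros f g simp: algebra_simps)
    \<comment> \<open>Substituting this eliminates the second derivative; the mixed terms in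
      \<open>f t * g t\<close> then cancel.\<close>
    have ph: "p * h t = - 2 * t * g t - q * f t"
      using ode[of t] by (simp add: p_def q_def algebra_simps)
    have "- (2 * f t * g t + ((2 * t * (g t)\<^sup>2 + p * (2 * g t * h t)) * q - p * (g t)\<^sup>2 * (c\<^sup>2 * (2 * t))) / (q * q))
      = - (2 * f t * g t + ((2 * t * (g t)\<^sup>2 + 2 * g t * (p * h t)) * q - p * (g t)\<^sup>2 * (c\<^sup>2 * (2 * t))) / (q * q))"
      by (simp add: ac_simps)
    also have "\<dots> = 2 * t * (g t)\<^sup>2 / q * (1 + c\<^sup>2 * p / q)"
      unfolding ph using pq by (simp add: divide_simps) (simp add: algebra_simps power2_eq_square)
    finally show "((\<lambda>t. - ?Q t) has_real_derivative ?G t) (at t)"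
      using d by (simp add: p_def q_def)
    show "?G t \<ge> 0" using pos c by (intro mult_nonneg_nonneg divide_nonneg_pos add_nonneg_nonneg) auto
  next
    fix a b assume ab: "max (sqrt \<kappa> / c) 1 < a" "a < b"
    obtain t where t: "t \<in> {a<..<b}" "g t \<noteq> 0" using prolate_derivative_nonzero[OF ab] by blast
    note pos = prolate_coefficients_pos[of t]
    have "1 + c\<^sup>2 * (t\<^sup>2 - 1) / (c\<^sup>2 * t\<^sup>2 - \<kappa>) > 0"
      using pos t ab c by (intro add_pos_nonneg divide_nonneg_pos mult_nonneg_nonneg) auto
    then have "?G t > 0" using pos t ab by (intro mult_pos_pos divide_pos_pos) auto
    then show "\<exists>t\<in>{a<..<b}. ?G t \<noteq> 0" using t by (intro bexI[of _ t]) auto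
  qed
  then show ?thesis unfolding monotone_on_def neg_less_iff_less by blast
qed

lemma strict_mono_prolate_Q_tilde:
  "strict_mono_on {max (sqrt \<kappa> / c) 1<..}
     (\<lambda>t. (t\<^sup>2 - 1) * ((c\<^sup>2 * t\<^sup>2 - \<kappa>) * (f t)\<^sup>2 + (t\<^sup>2 - 1) * (g t)\<^sup>2))" (is "strict_mono_on _ ?Q")
proof -
  let ?G = "\<lambda>t. 2 * t * (f t)\<^sup>2 * ((c\<^sup>2 * t\<^sup>2 - \<kappa>) + c\<^sup>2 * (t\<^sup>2 - 1))"
  show ?thesis
  proof (rule strict_mono_on_if_deriv_nonneg)
    fix t assume t: "t > max (sqrt \<kappa> / c) 1"
    note pos = prolate_coefficients_pos[OF t]
    define p where "p = t\<^sup>2 - 1"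
    define q where "q = c\<^sup>2 * t\<^sup>2 - \<kappa>"
    have d: "(?Q has_real_derivative
        2 * t * (q * (f t)\<^sup>2 + p * (g t)\<^sup>2) +
        p * (c\<^sup>2 * (2 * t) * (f t)\<^sup>2 + q * (2 * f t * g t) + (2 * t * (g t)\<^sup>2 + p * (2 * g t * h t)))) (at t)"
      unfolding p_def q_def
      by (auto intro!: derivative_eq_intros f g simp: algebra_simps power2_eq_square power3_eq_cube)
    \<comment> \<open>Here the substitution cancels both the mixed terms and all terms in
      \<open>(g t)\<^sup>2\<close>, leaving a multiple of \<open>(f t)\<^sup>2\<close>.\<close>
    have ph: "p * h t = - 2 * t * g t - q * f t"
      using ode[of t] by (simp add: p_def q_def algebra_simps)
    have "2 * t * (q * (f t)\<^sup>2 + p * (g t)\<^sup>2) +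
        p * (c\<^sup>2 * (2 * t) * (f t)\<^sup>2 + q * (2 * f t * g t) + (2 * t * (g t)\<^sup>2 + p * (2 * g t * h t)))
      = 2 * t * (q * (f t)\<^sup>2 + p * (g t)\<^sup>2) +
        p * (c\<^sup>2 * (2 * t) * (f t)\<^sup>2 + q * (2 * f t * g t) + (2 * t * (g t)\<^sup>2 + 2 * g t * (p * h t)))"
      by (simp add: ac_simps)
    also have "\<dots> = 2 * t * (f t)\<^sup>2 * (q + c\<^sup>2 * p)"
      unfolding ph by (simp add: algebra_simps power2_eq_square)
    finally show "(?Q has_real_derivative ?G t) (at t)"
      using d by (simp add: p_def q_def)
    show "?G t \<ge> 0" using pos c by (intro mult_nonneg_nonneg add_nonneg_nonneg) auto
  next
    fix a b assume ab: "max (sqrt \<kappa> / c) 1 < a" "a < b"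
    obtain t where t: "t \<in> {a<..<b}" "f t \<noteq> 0" using nonzero[OF ab(2)] by blast
    note pos = prolate_coefficients_pos[of t]
    have "?G t > 0" using pos t ab c by (intro mult_pos_pos add_pos_pos) auto
    then show "\<exists>t\<in>{a<..<b}. ?G t \<noteq> 0" using t by (intro bexI[of _ t]) auto
  qed
qed

end

section \<open>Regularity of the prolate functions and the final assembly\<close>

lemma pswf_systemD:
  assumes "pswf_system c \<psi> lam chi"
  shows "(\<lambda>t. (\<psi> n t)\<^sup>2) integrable_on {-1..1}" "integral {-1..1} (\<lambda>t. (\<psi> n t)\<^sup>2) = 1"
    and "lam n * complex_of_real (\<psi> n x) = fin_fourier c (\<psi> n) x"
    and "chi n > 0"
    and "(1 - x\<^sup>2) * deriv (deriv (\<psi> n)) x - 2 * x * deriv (\<psi> n) x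
      + (chi n - c\<^sup>2 * x\<^sup>2) * \<psi> n x = 0"
  using assms unfolding pswf_system_def by simp_all

text \<open>Regularity is gained in stages: measurable by the differential equation, integrable by
  comparison with the square, \<open>lam n\<close> nonzero by injectivity, continuous by the
  eigenvalue equation, and finally entire.\<close>

lemma pswf_entire_extension:
  assumes c: "c > 0" and sys: "pswf_system c \<psi> lam chi"
  obtains H where "H holomorphic_on UNIV" "\<And>x. H (of_real x) = of_real (\<psi> n x)"
proof -
  note sq = pswf_systemD(1,2)[OF sys, of n] and eig = pswf_systemD(3)[OF sys, of n]
    and ode = pswf_systemD(5)[OF sys, of _ n]
  have "\<psi> n \<in> borel_measurable borel"
  proof (rule borel_measurable_if_formal_ode)
    show "(1 - x\<^sup>2) * deriv (deriv (\<psi> n)) x + (- 2 * x) * deriv (\<psi> n) x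
        + (chi n - c\<^sup>2 * x\<^sup>2) * \<psi> n x = 0" for x
      using ode[of x] by simp
    have "{x. chi n - c\<^sup>2 * x\<^sup>2 = 0} \<subseteq> {sqrt (chi n) / c, - sqrt (chi n) / c}"
    proof
      fix x assume "x \<in> {x. chi n - c\<^sup>2 * x\<^sup>2 = 0}"
      then have "chi n = (c * x)\<^sup>2" by (simp add: power_mult_distrib)
      then have "sqrt (chi n) = \<bar>c * x\<bar>" by simp
      then show "x \<in> {sqrt (chi n) / c, - sqrt (chi n) / c}"
        using c by (cases "x \<ge> 0") (auto simp: abs_mult)
    qed
    then show "countable {x. chi n - c\<^sup>2 * x\<^sup>2 = 0}"
      by (meson countable_finite finite.emptyI finite.insertI finite_subset)
  qed auto
  then have meas: "\<psi> n \<in> borel_measurable (lebesgue_on {-1..1})"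
    by (intro measurable_restrict_space1 measurable_completion) auto
  have bnd: "\<bar>y\<bar> \<le> 1 + y\<^sup>2" for y :: real
    using sum_squares_bound[of "\<bar>y\<bar>" 1] by (simp add: power2_eq_square)
  have dom: "(\<lambda>t. 1 + (\<psi> n t)\<^sup>2) integrable_on {-1..1}"
    using sq(1) by (intro integrable_add) auto
  have "\<psi> n integrable_on {-1..1}"
    by (rule measurable_bounded_by_integrable_imp_integrable[OF meas dom]) (auto intro: bnd)
  then have abs: "\<psi> n absolutely_integrable_on {-1..1}"
    by (rule absolutely_integrable_integrable_bound[rotated]) (use bnd dom in auto)
  have lam: "lam n \<noteq> 0"
  proof
    assume l0: "lam n = 0"
    \<comment> \<open>Since \<open>c\<close> is nonzero, evaluating the eigenvalue equation at
      \<open>w / c\<close> reaches every frequency \<open>w\<close>.\<close>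
    have "integral {-1..1} (\<lambda>t. of_real (\<psi> n t) * exp (\<i> * of_real (w * t))) = 0" for w
      using eig[of "w / c"] l0 c by (simp add: fin_fourier_def)
    then have "negligible {t \<in> {-1..1}. \<psi> n t \<noteq> 0}"
      by (intro negligible_support_if_fourier_zero abs)
    then have "integral {-1..1} (\<lambda>t::real. 0) = integral {-1..1} (\<lambda>t. (\<psi> n t)\<^sup>2)"
      by (intro integral_spike[of "{t \<in> {-1..1}. \<psi> n t \<noteq> 0}"]) auto
    then show False using sq by simp
  qed
  have re: "\<psi> n = (\<lambda>x. Re (fin_fourier c (\<psi> n) x / lam n))"
  proof
    fix x
    have "fin_fourier c (\<psi> n) x / lam n = of_real (\<psi> n x)"
      using lam by (simp flip: eig)
    then show "\<psi> n x = Re (fin_fourier c (\<psi> n) x / lam n)" by simp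
  qed
  have "continuous_on {-1..1} (\<psi> n)"
    by (subst re) (use lam in \<open>intro continuous_intros continuous_on_subset[OF continuous_fin_fourier[OF abs]]\<close>, auto)
  note hol = holomorphic_fin_fourier_extension[OF this, of c]
  show thesis
  proof (rule that)
    show "(\<lambda>z. integral {-1..1} (\<lambda>t. complex_of_real (\<psi> n t) * exp (\<i> * (of_real c * z * of_real t))) / lam n)
        holomorphic_on UNIV"
      by (intro holomorphic_intros hol) (use lam in auto)
    show "integral {-1..1} (\<lambda>t. complex_of_real (\<psi> n t) * exp (\<i> * (of_real c * of_real x * of_real t))) / lam n
        = of_real (\<psi> n x)" for x
      using eig[of x] lam by (simp add: fin_fourier_def field_simps)
  qed
qed

theorem theorem34:
  fixes c :: real and \<psi> :: "nat \<Rightarrow> real \<Rightarrow> real" and lam :: "nat \<Rightarrow> complex"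
    and chi :: "nat \<Rightarrow> real" and n :: nat
  assumes "c > 0" and "pswf_system c \<psi> lam chi"
  shows "strict_antimono_on {max (sqrt (chi n) / c) 1<..}
           (\<lambda>t. (\<psi> n t)\<^sup>2 + (t\<^sup>2 - 1) * (deriv (\<psi> n) t)\<^sup>2 / (c\<^sup>2 * t\<^sup>2 - chi n))
      \<and> strict_mono_on {max (sqrt (chi n) / c) 1<..}
           (\<lambda>t. (t\<^sup>2 - 1) * ((c\<^sup>2 * t\<^sup>2 - chi n) * (\<psi> n t)\<^sup>2 + (t\<^sup>2 - 1) * (deriv (\<psi> n) t)\<^sup>2))"
proof -
  obtain H where H: "H holomorphic_on UNIV" and ext: "\<And>x. H (of_real x) = of_real (\<psi> n x)"
    using pswf_entire_extension[OF assms] by blast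
  have f: "(\<psi> n has_real_derivative deriv (\<psi> n) x) (at x)"
    and ext': "deriv H (of_real x) = of_real (deriv (\<psi> n) x)" for x
    using has_real_derivative_of_holomorphic_extension[OF H ext] by blast+
  \<comment> \<open>The extension lemma is used a second time, with \<open>deriv H\<close> extending
    \<open>deriv (\<psi> n)\<close>.\<close>
  have g: "(deriv (\<psi> n) has_real_derivative deriv (deriv (\<psi> n)) x) (at x)" for x
    by (rule has_real_derivative_of_holomorphic_extension(1)[where H = "deriv H"])
       (use H ext' in \<open>auto intro: holomorphic_deriv\<close>)
  note norm1 = pswf_systemD(2)[OF assms(2), of n] and chi = pswf_systemD(4)[OF assms(2), of n]
    and ode = pswf_systemD(5)[OF assms(2), of _ n]
  \<comment> \<open>Zeros filling an interval accumulate at its midpoint, so the identity theorem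
    makes \<open>H\<close> vanish everywhere, against the normalization of
    \<open>\<psi> n\<close>.\<close>
  have nonzero: "\<exists>t\<in>{a<..<b}. \<psi> n t \<noteq> 0" if ab: "a < b" for a b
  proof (rule ccontr)
    assume *: "\<not> ?thesis"
    define m where "m = (a + b) / 2"
    have m: "m islimpt {a<..<b}" using ab by (intro open_imp_islimpt) (auto simp: m_def)
    have lim: "complex_of_real m islimpt of_real ` {a<..<b}"
      by (rule islimpt_isCont_image[OF m]) (auto simp: eventually_at_filter)
    have "H z = 0" for z
      by (rule analytic_continuation[OF H _ _ _ _ lim]) (use * ext in auto)
    then have "\<psi> n t = 0" for t using ext[of t] by simp
    then show False using norm1 by simp
  qed
  show ?thesis
    using strict_antimono_prolate_Q[OF assms(1) chi f g ode nonzero]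
      strict_mono_prolate_Q_tilde[OF assms(1) chi f g ode nonzero] by blast
qed

end
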